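(* Let $F\subsetneq F(\theta)$ be differential fields of characteristic zero with $\theta$ transcendental over $F$, let $f=f(\theta)\in F(\theta)\setminus\{0,1\}$, and let $P,Q,R\in F[\theta]$, $\eta,\xi\in F$, distinct $\alpha_1,\dots,\alpha_t\in\overline{F}$, integers $a_1,\dots,a_t,b_1,\dots,b_t$ and the differential field $E$ be as in the context, so that $f=\eta\prod_{j=1}^t(\theta-\alpha_j)^{a_j}$ and $1-f=\xi\prod_{j=1}^t(\theta-\alpha_j)^{b_j}$. If $\deg(P)\le\deg(Q)$, then: (i) $S_1:=\sum_{k=1}^t\left(a_k\ell_2(\eta)+a_k\log\eta\log\xi-\frac12 b_k\log^2\eta\right)$ is a constant in $F$. (ii) $S_2:=\sum_{k=1}^t\left(a_k\log\xi-b_k\log\eta\right)$ is a constant in $F$. (iii) For some constants $c,d_k$ ($1\le k\le t$) and $e$, $$\ell_2(f(\theta))=\ell_2(\eta)-\sum_{\substack{j,k=1\\k\neq j}}^t a_jb_k\,\ell_2\!\left(\frac{\theta-\alpha_j}{\theta-\alpha_k}\right)-\frac12\sum_{j,k=1}^t a_jb_k\log^2(\theta-\alpha_k)-\sum_{k=1}^t b_k\log(\theta-\alpha_k)\log\eta-e\log\eta+\sum_{k=1}^t d_k\log(\theta-\alpha_k)+c.$$ (iv) For any $j\neq k$ there are constants $c_{jk}$ and $d_{jk}$ such that $$\ell_2\!\left(\frac{\theta-\alpha_j}{\theta-\alpha_k}\right)=-\ell_2\!\left(\frac{\theta-\alpha_k}{\theta-\alpha_j}\right)+\log(\theta-\a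lpha_j)\log(\theta-\alpha_k)-\frac12\left(\log^2(\theta-\alpha_j)+\log^2(\theta-\alpha_k)\right)+d_{jk}\log\!\left(\frac{\theta-\alpha_j}{\theta-\alpha_k}\right)+c_{jk}.$$
   Context: All fields have characteristic zero; a differential field is a field with a single derivation $'$; $C_F$ denotes the field of constants (kernel of the derivation) of $F$; $\overline{F}$ is an algebraic closure of $F$. For $y\neq 0$, $\log(y)$ denotes an element with $\log(y)'=y'/y$. For $g\notin\{0,1\}$ in a differential field, $\ell_2(g)$ denotes a dilogarithm (dilogarithmic integral) of $g$: an element such that $\ell_2(g)'=(g'/g)\vartheta$ for some element $\vartheta$ with $\vartheta'=-(1-g)'/(1-g)$; that is, $\ell_2(g)'=-(g'/g)\log(1-g)$. Data associated with $f$: choose monic coprime polynomials $P,Q\in F[\theta]$ and elements $\eta,\xi\in F$ so that $f=\eta P/Q$ and $1-f=(Q-\eta P)/Q$, where $R\in F[\theta]$ is the monic polynomial with $\xi R=Q-\eta P$ (so $R$ is coprime to both $P$ and $Q$). Let $\alpha_1,\dots,\alpha_t\in\overline{F}$ be distinct elements, and $0\le m\le n\le t$, such that $$P=\prod_{j=1}^m(\theta-\alpha_j)^{a_j},\qquad \frac1Q=\prod_{j=m+1}^n(\theta-\alpha_j)^{a_j},\qquad R=\prod_{j=n+1}^t(\theta-\alpha_j)^{b_j},$$ where $a_1,\dots,a_m$ are positive integers, $a_{m+1},\dots,a_n$ are negative integers and $b_{n+1},\dots,b_t$ are positive integers. Put $a_{n+1}=\dots=a_t=0$, $b_1=\dots=b_m=0$,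 and $b_j=a_j$ for $j=m+1,\dots,n$. $E$ is any differential field extension of $\overline{F}$, with $C_E=C_F$, containing $\ell_2(\eta)$, $\log\eta$, $\log\xi$ and $\log(\alpha_i-\alpha_j)$ for all $i\neq j$. The remaining logarithms and dilogarithms in the identities (those involving $\theta$) are taken, together with $E$ and $F(\theta)$, in a common differential field extension with field of constants $C_F$; "constant" means an element of derivative zero.
   Formalization: If deg P < deg Q, or if η = 1, ℓ₂(η) means an element with derivative −(η'/η) log ξ, with the same log ξ as in (i), not the dilogarithm of η: for f = x/eˣ over C(x) the literal (i) is false, and ℓ₂(1) is undefined. *)

theory Defs
  imports Complex_Main "HOL-Computational_Algebra.Computational_Algebra"
begin

text \<open>All fields live inside one ambient differential field: a type of class field_char_0 with a
  derivation D on it.  Subfields, and the fields generated by elements, are subsets of that type.\<close>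

definition derivation :: "('a::field \<Rightarrow> 'a) \<Rightarrow> bool" where
  "derivation D \<longleftrightarrow> (\<forall>x y. D (x + y) = D x + D y) \<and> (\<forall>x y. D (x * y) = D x * y + x * D y)"

definition is_subfield :: "'a::field set \<Rightarrow> bool" where
  "is_subfield K \<longleftrightarrow> 0 \<in> K \<and> 1 \<in> K \<and> (\<forall>x\<in>K. \<forall>y\<in>K. x + y \<in> K \<and> x * y \<in> K)
     \<and> (\<forall>x\<in>K. - x \<in> K \<and> inverse x \<in> K)"

definition differential_subfield :: "('a::field \<Rightarrow> 'a) \<Rightarrow> 'a set \<Rightarrow> bool" where
  "differential_subfield D K \<longleftrightarrow> is_subfield K \<and> D ` K \<subseteq> K"

definition adjoin :: "'a::field set \<Rightarrow> 'a \<Rightarrow> 'a set" where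
  "adjoin K x = is_subfield hull (insert x K)"

definition constants :: "('a::field \<Rightarrow> 'a) \<Rightarrow> 'a set \<Rightarrow> 'a set" where
  "constants D K = {x \<in> K. D x = 0}"

definition poly_over :: "'a::field set \<Rightarrow> 'a poly \<Rightarrow> bool" where
  "poly_over K p \<longleftrightarrow> (\<forall>i. coeff p i \<in> K)"

definition algebraic_over :: "'a::field set \<Rightarrow> 'a \<Rightarrow> bool" where
  "algebraic_over K x \<longleftrightarrow> (\<exists>p. poly_over K p \<and> p \<noteq> 0 \<and> poly p x = 0)"

abbreviation transcendental_over :: "'a::field set \<Rightarrow> 'a \<Rightarrow> bool" where
  "transcendental_over K x \<equiv> \<not> algebraic_over K x"

definition is_algebraic_closure :: "'a::field set \<Rightarrow> 'a set \<Rightarrow> bool" where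
  "is_algebraic_closure K L \<longleftrightarrow> is_subfield L \<and> K \<subseteq> L \<and> (\<forall>x\<in>L. algebraic_over K x)
     \<and> (\<forall>p. poly_over L p \<and> degree p > 0 \<longrightarrow> (\<exists>x\<in>L. poly p x = 0))"

text \<open>Logarithms and dilogarithms are determined only up to the choice of constants of integration,
  so they are relations: the last argument is one of the possible values.\<close>

definition is_log :: "('a::field \<Rightarrow> 'a) \<Rightarrow> 'a \<Rightarrow> 'a \<Rightarrow> bool" where
  "is_log D y l \<longleftrightarrow> y \<noteq> 0 \<and> D l = D y / y"

definition is_dilog :: "('a::field \<Rightarrow> 'a) \<Rightarrow> 'a \<Rightarrow> 'a \<Rightarrow> bool" where
  "is_dilog D g l \<longleftrightarrow> g \<noteq> 0 \<and> g \<noteq> 1 \<and>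
     (\<exists>\<theta>. D \<theta> = - (D (1 - g) / (1 - g)) \<and> D l = D g / g * \<theta>)"

text \<open>The dilogarithm of the leading factor \<eta> of f = \<eta> P / Q, where 1 - f = \<xi> R / Q and
  l\<xi> is a logarithm of \<xi>.  If deg P = deg Q and \<eta> is not 1, then \<xi> = 1 - \<eta> and this
  is an ordinary dilogarithm of \<eta>.  In the degenerate cases \<xi> plays the role of 1 - \<eta>:
  the derivative is -(D \<eta> / \<eta>) l\<xi>.  This covers \<eta> = 1, where is_dilog is undefined (the value
  is then any constant), and deg P < deg Q, where \<xi> = 1.  In the latter case an ordinary
  dilogarithm of a non-constant \<eta> would make the identities false: for f = x / exp x over the
  field C(x) one has \<eta> = x and \<xi> = 1, and a dilogarithm of x is not of the form
  c + e log x.\<close>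

definition is_leading_dilog ::
  "('a::field \<Rightarrow> 'a) \<Rightarrow> 'a poly \<Rightarrow> 'a poly \<Rightarrow> 'a \<Rightarrow> 'a \<Rightarrow> 'a \<Rightarrow> bool" where
  "is_leading_dilog D P Q \<eta> l\<xi> l \<longleftrightarrow>
     (if degree P = degree Q \<and> \<eta> \<noteq> 1 then is_dilog D \<eta> l else D l = - (D \<eta> / \<eta> * l\<xi>))"

end

theory Submission
  imports Defs
begin

text \<open>Write \<open>\<partial>x\<close> for \<open>D x / x\<close>.  Every dilogarithm here has derivative \<open>\<partial>g\<close> times
  a constant minus \<open>log (1 - g)\<close>, and \<open>\<partial>f\<close>, \<open>\<partial>(1 - f)\<close> are linear in
  the \<open>\<partial>(\<theta> - \<alpha>\<^sub>k)\<close>.  Comparing derivatives of the two sides of (iii), the quadratic terms cancel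
  and what is left is \<open>\<Sum>\<^sub>k d\<^sub>k \<partial>(\<theta> - \<alpha>\<^sub>k)\<close> plus a constant multiple of \<open>\<partial>\<eta>\<close>, where
  \<open>d\<^sub>k\<close> is a combination of \<open>log \<eta>\<close>, \<open>log \<xi>\<close> and \<open>log (\<alpha>\<^sub>i - \<alpha>\<^sub>j)\<close>.
  That \<open>d\<^sub>k\<close> is constant is the logarithmic derivative of the identity \<open>Q = \<eta> P + \<xi> R\<close>
  evaluated at \<open>\<alpha>\<^sub>k\<close>, where exactly one of the three terms vanishes.\<close>

section \<open>Derivation rules\<close>

locale field_derivation =
  fixes D :: "'a::field_char_0 \<Rightarrow> 'a"
  assumes derivation: "derivation D"
begin

lemma D_add [simp]: "D (x + y) = D x + D y"
  using derivation unfolding derivation_def by blast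

lemma D_mult [simp]: "D (x * y) = D x * y + x * D y"
  using derivation unfolding derivation_def by blast

lemma D_0 [simp]: "D 0 = 0"
  using D_add[of 0 0] by simp

lemma D_1 [simp]: "D 1 = 0"
  using D_mult[of 1 1] by simp

lemma D_minus [simp]: "D (- x) = - D x"
  using D_add[of x "- x"] by (simp add: add_eq_0_iff)

lemma D_diff [simp]: "D (x - y) = D x - D y"
  using D_add[of x "- y"] by simp

lemma D_sum [simp]: "D (sum f A) = (\<Sum>x\<in>A. D (f x))"
  by (induction A rule: infinite_finite_induct) auto

lemma D_of_nat [simp]: "D (of_nat n) = 0"
  by (induction n) auto

lemma D_of_int [simp]: "D (of_int n) = 0"
  by (cases n) (auto simp del: of_nat_Suc)

lemma D_numeral [simp]: "D (numeral w) = 0"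
  using D_of_nat[of "numeral w"] by simp

lemma D_inverse: "D (inverse x) = - D x / x ^ 2"
proof (cases "x = 0")
  case False
  have "D (x * inverse x) = 0"
    using False by simp
  then have "x * D (inverse x) = - D x * inverse x"
    unfolding D_mult by (simp add: add_eq_0_iff)
  with False show ?thesis
    by (simp add: field_simps power2_eq_square)
qed simp

lemma D_divide: "D (x / y) = D x / y - x * D y / y ^ 2"
  by (simp add: divide_inverse D_inverse)

lemma D_divide_numeral [simp]: "D (x / numeral w) = D x / numeral w"
  by (simp add: D_divide)

lemma D_power2 [simp]: "D (x ^ 2) = 2 * x * D x"
  by (simp add: power2_eq_square)

section \<open>Logarithmic derivatives\<close>

definition dlog :: "'a \<Rightarrow> 'a" where
  "dlog x = D x / x"

text \<open>The junk value at 0 lets sums of \<open>dlog (\<alpha> k - \<alpha> j)\<close> below run over all \<open>j\<close>: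
  the term \<open>j = k\<close> vanishes.\<close>

lemma dlog_0 [simp]: "dlog 0 = 0" and dlog_1 [simp]: "dlog 1 = 0"
  by (simp_all add: dlog_def)

lemma dlog_minus [simp]: "dlog (- x) = dlog x"
  by (simp add: dlog_def)

lemma dlog_minus_commute: "dlog (x - y) = dlog (y - x)"
  using dlog_minus[of "y - x"] by simp

lemma dlog_mult: "x \<noteq> 0 \<Longrightarrow> y \<noteq> 0 \<Longrightarrow> dlog (x * y) = dlog x + dlog y"
  by (simp add: dlog_def field_simps)

lemma dlog_divide: "x \<noteq> 0 \<Longrightarrow> y \<noteq> 0 \<Longrightarrow> dlog (x / y) = dlog x - dlog y"
  by (simp add: dlog_def D_divide field_simps power2_eq_square)

lemma dlog_power: "dlog (x ^ n) = of_nat n * dlog x"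
proof (cases "x = 0")
  case True
  then show ?thesis by (cases n) auto
next
  case False
  then show ?thesis by (induction n) (auto simp: dlog_mult algebra_simps)
qed

lemma dlog_prod: "(\<forall>i\<in>A. f i \<noteq> 0) \<Longrightarrow> dlog (prod f A) = (\<Sum>i\<in>A. dlog (f i))"
  by (induction A rule: infinite_finite_induct) (auto simp: dlog_mult)

text \<open>Integer exponents with \<open>nat\<close> let one statement serve \<open>P\<close> and
  \<open>R\<close> as well as \<open>Q\<close>, whose multiplicities are
  \<open>- a j\<close>.\<close>

lemma dlog_poly_prod_linear:
  assumes "finite J" and "\<forall>j\<in>J. r j \<ge> 0" and "poly (\<Prod>j\<in>J. [:- \<alpha> j, 1:] ^ nat (r j)) x \<noteq> 0"
  shows "dlog (poly (\<Prod>j\<in>J. [:- \<alpha> j, 1:] ^ nat (r j)) x) = (\<Sum>j\<in>J. of_int (r j) * dlog (x - \<alpha> j))"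
proof -
  have "dlog (poly (\<Prod>j\<in>J. [:- \<alpha> j, 1:] ^ nat (r j)) x) = dlog (\<Prod>j\<in>J. (x - \<alpha> j) ^ nat (r j))"
    by (simp add: poly_prod)
  also have "\<dots> = (\<Sum>j\<in>J. dlog ((x - \<alpha> j) ^ nat (r j)))"
    using assms by (intro dlog_prod) (auto simp: poly_prod)
  also have "\<dots> = (\<Sum>j\<in>J. of_int (r j) * dlog (x - \<alpha> j))"
    using assms(2) by (intro sum.cong) (auto simp: dlog_power)
  finally show ?thesis .
qed

lemma D_is_log: "is_log D y l \<Longrightarrow> D l = dlog y"
  by (simp add: is_log_def dlog_def)

section \<open>Derivatives of dilogarithms\<close>

text \<open>The logarithm hidden in \<open>is_dilog\<close> has the same derivative as
  \<open>- u\<close>, so the two differ by a constant. This replaces the hidden logarithm by a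
  chosen one.\<close>

lemma is_dilog_derivE:
  assumes "is_dilog D g l" and "D u = dlog (1 - g)"
  obtains c where "D c = 0" and "D l = dlog g * (c - u)"
proof -
  obtain v where "D v = - dlog (1 - g)" "D l = dlog g * v"
    using assms(1) unfolding is_dilog_def dlog_def by blast
  then show ?thesis
    using that[of "v + u"] assms(2) by simp
qed

text \<open>One minus the quotient is \<open>(\<beta> - \<gamma>) / (\<theta> - \<gamma>)\<close>,
  so \<open>w - v\<close> can serve as its logarithm.\<close>

lemma is_dilog_quotient_derivE:
  assumes "is_dilog D ((\<theta> - \<beta>) / (\<theta> - \<gamma>)) l" and "\<beta> \<noteq> \<gamma>"
    and "is_log D (\<theta> - \<beta>) u" and "is_log D (\<theta> - \<gamma>) v" and "is_log D (\<beta> - \<gamma>) w"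
  obtains c where "D c = 0" and "D l = (D u - D v) * (v - w + c)"
proof -
  have nz: "\<theta> - \<beta> \<noteq> 0" "\<theta> - \<gamma> \<noteq> 0"
    using assms(3,4) by (auto simp: is_log_def)
  have "1 - (\<theta> - \<beta>) / (\<theta> - \<gamma>) = (\<beta> - \<gamma>) / (\<theta> - \<gamma>)"
    using nz by (simp add: field_simps)
  then have "D (w - v) = dlog (1 - (\<theta> - \<beta>) / (\<theta> - \<gamma>))"
    using nz assms by (simp add: dlog_divide D_is_log)
  then obtain c where "D c = 0" "D l = dlog ((\<theta> - \<beta>) / (\<theta> - \<gamma>)) * (c - (w - v))"
    using is_dilog_derivE[OF assms(1)] by blast
  then show ?thesis
    using that[of c] nz assms by (simp add: dlog_divide D_is_log algebra_simps)
qed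

text \<open>The derivative of \<open>l + l'\<close> is \<open>D u - D v\<close> times
  \<open>v - u\<close> plus a constant. The part with \<open>v - u\<close> integrates to minus half
  the square of \<open>u - v\<close>, and the constant part to a multiple of
  \<open>q\<close>.\<close>

lemma dilog_quotient_inversion:
  assumes "is_dilog D ((\<theta> - \<beta>) / (\<theta> - \<gamma>)) l" and "is_dilog D ((\<theta> - \<gamma>) / (\<theta> - \<beta>)) l'"
    and "\<beta> \<noteq> \<gamma>"
    and u: "is_log D (\<theta> - \<beta>) u" and v: "is_log D (\<theta> - \<gamma>) v"
    and w: "is_log D (\<beta> - \<gamma>) w" and w': "is_log D (\<gamma> - \<beta>) w'"
    and q: "is_log D ((\<theta> - \<beta>) / (\<theta> - \<gamma>)) q"
  shows "\<exists>c d. D c = 0 \<and> D d = 0 \<and> l = - l' + u * v - 1/2 * (u ^ 2 + v ^ 2) + d * q + c"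
proof -
  obtain c1 where c1: "D c1 = 0" "D l = (D u - D v) * (v - w + c1)"
    using is_dilog_quotient_derivE[OF assms(1,3) u v w] .
  obtain c2 where c2: "D c2 = 0" "D l' = (D v - D u) * (u - w' + c2)"
    using is_dilog_quotient_derivE[OF assms(2) assms(3)[symmetric] v u w'] .
  have Dq: "D q = D u - D v"
    using u v unfolding D_is_log[OF q] D_is_log[OF u] D_is_log[OF v]
    by (intro dlog_divide) (auto simp: is_log_def)
  \<comment> \<open>The constants left over in the two derivatives; \<open>w' - w\<close> is
    constant because \<open>dlog\<close> is even.\<close>
  define d where "d = c1 - c2 + w' - w"
  have Dd: "D d = 0"
    unfolding d_def by (simp add: c1(1) c2(1) D_is_log[OF w] D_is_log[OF w'] dlog_minus_commute)
  \<comment> \<open>Taking \<open>c\<close> to be the defect of the identity leaves only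
    \<open>D c = 0\<close> to prove.\<close>
  define c where "c = l - (- l' + u * v - 1/2 * (u ^ 2 + v ^ 2) + d * q)"
  have "D c = D l + D l' - (D u * v + u * D v - (u * D u + v * D v) + d * (D u - D v))"
    by (simp add: c_def Dd Dq add_divide_distrib)
  also have "\<dots> = 0"
    unfolding c1(2) c2(2) d_def by (simp add: algebra_simps)
  finally show ?thesis
    using Dd by (intro exI[of _ c] exI[of _ d]) (simp add: c_def)
qed

section \<open>Expansion of the dilogarithm of a product\<close>

text \<open>Part (iii) with the polynomials stripped away: the exponents are arbitrary constants,
  and \<open>P\<close>, \<open>Q\<close>, \<open>R\<close> survive only through
  \<open>dlog_f\<close>, \<open>dlog_1f\<close> and \<open>compat\<close>. The constant
  \<open>e\<^sub>0\<close> absorbs the choice made in the dilogarithm of \<eta>.\<close>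

lemma dilog_product_expansion:
  fixes T :: "'i set" and a b \<alpha> L :: "'i \<Rightarrow> 'a" and \<Lambda> l2 :: "'i \<Rightarrow> 'i \<Rightarrow> 'a"
  assumes "finite T" and "inj_on \<alpha> T"
    and a: "\<And>k. D (a k) = 0" and b: "\<And>k. D (b k) = 0"
    and dlog_f: "dlog f = dlog \<eta> + (\<Sum>k\<in>T. a k * dlog (\<theta> - \<alpha> k))"
    and dlog_1f: "dlog (1 - f) = dlog \<xi> + (\<Sum>k\<in>T. b k * dlog (\<theta> - \<alpha> k))"
    and compat: "\<And>k. k \<in> T \<Longrightarrow>
      a k * (dlog \<xi> + (\<Sum>j\<in>T. b j * dlog (\<alpha> k - \<alpha> j))) =
      b k * (dlog \<eta> + (\<Sum>j\<in>T. a j * dlog (\<alpha> k - \<alpha> j)))"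
    and log\<eta>: "is_log D \<eta> log\<eta>" and log\<xi>: "is_log D \<xi> log\<xi>"
    and "D e\<^sub>0 = 0" and l2\<eta>: "D l2\<eta> = dlog \<eta> * (e\<^sub>0 - log\<xi>)"
    and L: "\<And>k. k \<in> T \<Longrightarrow> is_log D (\<theta> - \<alpha> k) (L k)"
    and \<Lambda>: "\<And>j k. j \<in> T \<Longrightarrow> k \<in> T \<Longrightarrow> j \<noteq> k \<Longrightarrow> is_log D (\<alpha> j - \<alpha> k) (\<Lambda> j k)"
    and l2: "\<And>j k. j \<in> T \<Longrightarrow> k \<in> T \<Longrightarrow> j \<noteq> k \<Longrightarrow>
      is_dilog D ((\<theta> - \<alpha> j) / (\<theta> - \<alpha> k)) (l2 j k)"
    and l2f: "is_dilog D f l2f"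
  shows "\<exists>c d e. D c = 0 \<and> (\<forall>k\<in>T. D (d k) = 0) \<and> D e = 0 \<and>
    l2f = l2\<eta> - (\<Sum>j\<in>T. \<Sum>k\<in>T - {j}. a j * b k * l2 j k)
      - 1/2 * (\<Sum>j\<in>T. \<Sum>k\<in>T. a j * b k * L k ^ 2)
      - (\<Sum>k\<in>T. b k * L k * log\<eta>) - e * log\<eta> + (\<Sum>k\<in>T. d k * L k) + c"
proof -
  have DL: "D (L k) = dlog (\<theta> - \<alpha> k)" if "k \<in> T" for k
    using L[OF that] by (rule D_is_log)
  note [simp] = a b \<open>D e\<^sub>0 = 0\<close> D_is_log[OF log\<eta>] D_is_log[OF log\<xi>]
  have "D (log\<xi> + (\<Sum>k\<in>T. b k * L k)) = dlog (1 - f)"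
    by (simp add: dlog_1f DL)
  then obtain c\<^sub>0 where [simp]: "D c\<^sub>0 = 0"
    and Dl2f: "D l2f = dlog f * (c\<^sub>0 - (log\<xi> + (\<Sum>k\<in>T. b k * L k)))"
    using is_dilog_derivE[OF l2f] by blast
  have "\<exists>c. D c = 0 \<and> D (l2 j k) = (D (L j) - D (L k)) * (L k - \<Lambda> j k + c)"
    if "j \<in> T" "k \<in> T" "j \<noteq> k" for j k
    using is_dilog_quotient_derivE[OF l2[OF that] _ L L \<Lambda>[OF that]] that assms(2)
    by (metis inj_onD)
  then obtain C where C: "\<And>j k. j \<in> T \<Longrightarrow> k \<in> T \<Longrightarrow> j \<noteq> k \<Longrightarrow>
      D (C j k) = 0 \<and> D (l2 j k) = (D (L j) - D (L k)) * (L k - \<Lambda> j k + C j k)"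
    by metis
  \<comment> \<open>The zero diagonal agrees with \<open>dlog 0 = 0\<close>, so \<open>DM\<close>
    holds for \<open>j = k\<close> too and sums may run over all pairs.\<close>
  define M where "M j k = (if j = k then 0 else \<Lambda> j k - C j k)" for j k
  have DM: "D (M j k) = dlog (\<alpha> k - \<alpha> j)" if "j \<in> T" "k \<in> T" for j k
    using C[OF that] \<Lambda>[OF that] by (simp add: M_def D_is_log dlog_minus_commute)
  \<comment> \<open>This is the coefficient of \<open>D (L k)\<close> left after the terms with
    \<open>L\<close> cancel; the two sums over \<open>M\<close> come from splitting
    \<open>G j - G k\<close> in \<open>N\<close>.\<close>
  define d where "d k = c\<^sub>0 * a k - a k * log\<xi> + b k * log\<eta>
      - (\<Sum>j\<in>T. a k * b j * M k j - a j * b k * M j k)" for k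
  have Dd: "D (d k) = 0" if "k \<in> T" for k
  proof -
    \<comment> \<open>Since \<open>dlog\<close> is even, \<open>M k j\<close> and
      \<open>M j k\<close> have the same derivative. What remains is the difference of the two sides
      of \<open>compat\<close>.\<close>
    have "D (d k) = b k * dlog \<eta> - a k * dlog \<xi>
        - (\<Sum>j\<in>T. a k * b j * dlog (\<alpha> k - \<alpha> j) - a j * b k * dlog (\<alpha> k - \<alpha> j))"
      using that by (simp add: d_def DM dlog_minus_commute[of _ "\<alpha> k"])
    also have "\<dots> = b k * (dlog \<eta> + (\<Sum>j\<in>T. a j * dlog (\<alpha> k - \<alpha> j)))
        - a k * (dlog \<xi> + (\<Sum>j\<in>T. b j * dlog (\<alpha> k - \<alpha> j)))"
      by (simp add: sum_subtractf sum_distrib_left algebra_simps)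
    finally show ?thesis
      using compat[OF that] by simp
  qed
  define S where "S = (\<Sum>j\<in>T. \<Sum>k\<in>T - {j}. a j * b k * l2 j k)"
  \<comment> \<open>In these abbreviations the final comparison is a ring identity: \<open>X\<close>
    cancels between \<open>S\<close> and the squares, \<open>N\<close> between \<open>S\<close> and
    the linear terms.\<close>
  define G where "G k = D (L k)" for k
  define A where "A = (\<Sum>k\<in>T. a k * G k)"
  define B where "B = (\<Sum>k\<in>T. b k * G k)"
  define Z where "Z = (\<Sum>k\<in>T. b k * L k)"
  define X where "X = (\<Sum>j\<in>T. \<Sum>k\<in>T. a j * b k * (G k * L k))"
  define N where "N = (\<Sum>j\<in>T. \<Sum>k\<in>T. a j * b k * ((G j - G k) * M j k))"
  have DS: "D S = A * Z - X - N"
  proof -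
    have "D S = (\<Sum>j\<in>T. \<Sum>k\<in>T - {j}. a j * b k * ((G j - G k) * (L k - M j k)))"
      unfolding S_def D_sum
    proof (intro sum.cong refl)
      fix j k
      assume "j \<in> T" "k \<in> T - {j}"
      then have "D (l2 j k) = (G j - G k) * (L k - M j k)"
        using C[of j k] by (auto simp: G_def M_def)
      then show "D (a j * b k * l2 j k) = a j * b k * ((G j - G k) * (L k - M j k))"
        by simp
    qed
    \<comment> \<open>The added diagonal terms vanish because of the factor
      \<open>G j - G k\<close>.\<close>
    also have "\<dots> = (\<Sum>j\<in>T. \<Sum>k\<in>T. a j * b k * ((G j - G k) * (L k - M j k)))"
      using \<open>finite T\<close> by (intro sum.cong sum.mono_neutral_left) auto
    also have "\<dots> = (\<Sum>j\<in>T. \<Sum>k\<in>T. a j * G j * (b k * L k)) - X - N"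
      by (simp add: X_def N_def algebra_simps sum.distrib sum_subtractf)
    finally show ?thesis
      by (simp add: A_def Z_def sum_product)
  qed
  have D_linear: "(\<Sum>k\<in>T. D (d k * L k)) = (c\<^sub>0 - log\<xi>) * A + log\<eta> * B - N"
  proof -
    have "(\<Sum>k\<in>T. \<Sum>j\<in>T. a j * b k * M j k * G k) = (\<Sum>j\<in>T. \<Sum>k\<in>T. a j * b k * M j k * G k)"
      by (rule sum.swap)
    then have "(\<Sum>k\<in>T. d k * G k) = (c\<^sub>0 - log\<xi>) * A + log\<eta> * B - N"
      by (simp add: d_def A_def B_def N_def algebra_simps sum.distrib sum_subtractf
          sum_distrib_left)
    then show ?thesis
      using Dd by (simp add: G_def)
  qed
  have D_square: "D (1/2 * (\<Sum>j\<in>T. \<Sum>k\<in>T. a j * b k * L k ^ 2)) = X"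
    by (simp add: X_def G_def sum_divide_distrib mult_ac)
  have D_mixed: "D (\<Sum>k\<in>T. b k * L k * log\<eta>) = B * log\<eta> + Z * dlog \<eta>"
    by (simp add: B_def Z_def G_def sum.distrib sum_distrib_left mult_ac)
  have Dl2f': "D l2f = (dlog \<eta> + A) * (c\<^sub>0 - (log\<xi> + Z))"
    by (simp add: Dl2f dlog_f DL G_def A_def Z_def)
  \<comment> \<open>The choice \<open>e\<^sub>0 - c\<^sub>0\<close> for \<open>e\<close> matches the
    coefficients of \<open>dlog \<eta>\<close>.\<close>
  define c where "c = l2f - (l2\<eta> - S - 1/2 * (\<Sum>j\<in>T. \<Sum>k\<in>T. a j * b k * L k ^ 2)
      - (\<Sum>k\<in>T. b k * L k * log\<eta>) - (e\<^sub>0 - c\<^sub>0) * log\<eta> + (\<Sum>k\<in>T. d k * L k))"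
  have "D c = 0"
    unfolding c_def D_diff D_add D_square D_mixed Dl2f' l2\<eta> DS D_sum[of "\<lambda>k. d k * L k"] D_linear
    by (simp add: algebra_simps)
  with Dd show ?thesis
    by (intro exI[of _ c] exI[of _ d] exI[of _ "e\<^sub>0 - c\<^sub>0"]) (simp add: c_def S_def)
qed

end

section \<open>Degrees, roots and exponent sums\<close>

lemma degree_prod_linear:
  fixes \<alpha> :: "'i \<Rightarrow> 'a::field"
  assumes "\<forall>j\<in>J. r j \<ge> 0"
  shows "int (degree (\<Prod>j\<in>J. [:- \<alpha> j, 1:] ^ nat (r j))) = (\<Sum>j\<in>J. r j)"
  using assms by (subst degree_prod_eq_sum_degree) (auto simp: degree_linear_power)

lemma poly_prod_linear_eq_0_iff:
  fixes \<alpha> :: "'i \<Rightarrow> 'a::field"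
  assumes "finite J" and "inj_on \<alpha> T" and "J \<subseteq> T" and "k \<in> T" and "\<forall>j\<in>J. r j > 0"
  shows "poly (\<Prod>j\<in>J. [:- \<alpha> j, 1:] ^ nat (r j)) (\<alpha> k) = 0 \<longleftrightarrow> k \<in> J"
proof -
  have "poly (\<Prod>j\<in>J. [:- \<alpha> j, 1:] ^ nat (r j)) (\<alpha> k) = 0 \<longleftrightarrow> (\<exists>j\<in>J. \<alpha> k = \<alpha> j)"
    using assms(1,5) by (simp add: poly_prod)
  also have "\<dots> \<longleftrightarrow> k \<in> J"
    using assms(2-4) by (metis inj_on_def subsetD)
  finally show ?thesis .
qed

text \<open>Compare coefficients at \<open>degree Q\<close>: the right side gives \<kappa>, which is
  nonzero because the last hypothesis excludes cancellation of the leading terms.\<close>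

lemma leading_coeff_monic_diff:
  fixes P Q R :: "'a::field poly"
  assumes "lead_coeff P = 1" "lead_coeff Q = 1" "lead_coeff R = 1"
    and "smult \<xi> R = Q - smult \<eta> P" and "degree P \<le> degree Q"
    and "degree P = degree Q \<Longrightarrow> \<eta> \<noteq> 1"
  shows "degree R = degree Q" and "\<xi> = (if degree P = degree Q then 1 - \<eta> else 1)"
proof -
  define \<kappa> where "\<kappa> = (if degree P = degree Q then 1 - \<eta> else 1)"
  have "coeff (smult \<xi> R) (degree Q) = \<kappa>"
    using assms by (auto simp: \<kappa>_def coeff_eq_0)
  moreover have "\<kappa> \<noteq> 0"
    using assms(6) by (auto simp: \<kappa>_def)
  moreover have "degree (smult \<xi> R) \<le> degree Q"
    unfolding assms(4) using assms(5) by (intro degree_diff_le) auto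
  ultimately have "degree (smult \<xi> R) = degree Q" "\<xi> \<noteq> 0"
    by (metis le_antisym le_degree, auto)
  then show "degree R = degree Q"
    by simp
  with \<open>coeff (smult \<xi> R) (degree Q) = \<kappa>\<close> assms(3)
  show "\<xi> = (if degree P = degree Q then 1 - \<eta> else 1)"
    by (simp add: \<kappa>_def)
qed

lemma sum_atLeastAtMost_split3:
  fixes g :: "nat \<Rightarrow> 'a::comm_monoid_add"
  assumes "m \<le> n" and "n \<le> t"
  shows "(\<Sum>k=1..t. g k) = (\<Sum>k=1..m. g k) + (\<Sum>k=m+1..n. g k) + (\<Sum>k=n+1..t. g k)"
proof -
  have "{1..t} = {1..m} \<union> {m+1..n} \<union> {n+1..t}"
    using assms by auto
  moreover have "sum g ({1..m} \<union> {m+1..n} \<union> {n+1..t})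
      = sum g ({1..m} \<union> {m+1..n}) + sum g {n+1..t}"
    using assms by (intro sum.union_disjoint) auto
  moreover have "sum g ({1..m} \<union> {m+1..n}) = sum g {1..m} + sum g {m+1..n}"
    by (intro sum.union_disjoint) auto
  ultimately show ?thesis
    by simp
qed

text \<open>Both sums become numerator minus denominator: \<open>P\<close> against \<open>Q\<close>
  for \<open>f\<close>, and \<open>R\<close> against \<open>Q\<close> for
  \<open>1 - f\<close>.\<close>

lemma sum_exponents_split:
  fixes a b :: "nat \<Rightarrow> int" and g :: "nat \<Rightarrow> 'a::comm_ring_1"
  assumes "m \<le> n" and "n \<le> t"
    and "\<forall>j\<in>{1..m}. b j = 0" and "\<forall>j\<in>{m+1..n}. b j = a j" and "\<forall>j\<in>{n+1..t}. a j = 0"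
  shows "(\<Sum>k=1..t. of_int (a k) * g k)
      = (\<Sum>k=1..m. of_int (a k) * g k) - (\<Sum>k=m+1..n. of_int (- a k) * g k)"
    and "(\<Sum>k=1..t. of_int (b k) * g k)
      = (\<Sum>k=n+1..t. of_int (b k) * g k) - (\<Sum>k=m+1..n. of_int (- a k) * g k)"
proof -
  have "(\<Sum>k=n+1..t. of_int (a k) * g k) = 0" "(\<Sum>k=1..m. of_int (b k) * g k) = 0"
    using assms by (simp_all add: sum.neutral)
  moreover have "(\<Sum>k=m+1..n. of_int (b k) * g k) = (\<Sum>k=m+1..n. of_int (a k) * g k)"
    using assms by (intro sum.cong) auto
  ultimately show "(\<Sum>k=1..t. of_int (a k) * g k)
      = (\<Sum>k=1..m. of_int (a k) * g k) - (\<Sum>k=m+1..n. of_int (- a k) * g k)"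
    and "(\<Sum>k=1..t. of_int (b k) * g k)
      = (\<Sum>k=n+1..t. of_int (b k) * g k) - (\<Sum>k=m+1..n. of_int (- a k) * g k)"
    unfolding sum_atLeastAtMost_split3[OF assms(1,2)] by (simp_all add: sum_negf)
qed

section \<open>The four identities\<close>

theorem proposition4p2:
  fixes D :: "'a::field_char_0 \<Rightarrow> 'a"
    and F Fbar E :: "'a set"
    and \<theta> f \<eta> \<xi> :: 'a
    and P Q R :: "'a poly"
    and \<alpha> :: "nat \<Rightarrow> 'a"
    and a b :: "nat \<Rightarrow> int"
    and m n t :: nat
    and l2\<eta> log\<eta> log\<xi> l2f :: 'a
    and log\<alpha> l2\<theta> logq :: "nat \<Rightarrow> nat \<Rightarrow> 'a"
    and log\<theta> :: "nat \<Rightarrow> 'a"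
  assumes "derivation D"
    and "differential_subfield D F"
    and "transcendental_over F \<theta>"
    and "differential_subfield D (adjoin F \<theta>)"
    and "is_algebraic_closure F Fbar"
    \<comment> \<open>the common differential field extension has field of constants that of F\<close>
    and "constants D UNIV = constants D F"
    \<comment> \<open>the data associated with f\<close>
    and "f \<in> adjoin F \<theta>" and "f \<noteq> 0" and "f \<noteq> 1"
    and "poly_over F P" and "poly_over F Q" and "poly_over F R"
    and "\<eta> \<in> F" and "\<xi> \<in> F"
    and "lead_coeff P = 1" and "lead_coeff Q = 1" and "lead_coeff R = 1"
    and "coprime P Q"
    and "f = \<eta> * poly P \<theta> / poly Q \<theta>"
    and "smult \<xi> R = Q - smult \<eta> P"
    and "m \<le> n" and "n \<le> t"
    and "\<alpha> ` {1..t} \<subseteq> Fbar" and "inj_on \<alpha> {1..t}"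
    and "\<forall>j\<in>{1..m}. a j > 0 \<and> b j = 0"
    and "\<forall>j\<in>{m+1..n}. a j < 0 \<and> b j = a j"
    and "\<forall>j\<in>{n+1..t}. a j = 0 \<and> b j > 0"
    and "P = (\<Prod>j=1..m. [:- \<alpha> j, 1:] ^ nat (a j))"
    and "Q = (\<Prod>j=m+1..n. [:- \<alpha> j, 1:] ^ nat (- a j))"
    and "R = (\<Prod>j=n+1..t. [:- \<alpha> j, 1:] ^ nat (b j))"
    \<comment> \<open>the field E and the logarithms and dilogarithm in it\<close>
    and "differential_subfield D E" and "Fbar \<subseteq> E"
    and "constants D E = constants D F"
    and "l2\<eta> \<in> E" and "is_leading_dilog D P Q \<eta> log\<xi> l2\<eta>"
    and "log\<eta> \<in> E" and "is_log D \<eta> log\<eta>"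
    and "log\<xi> \<in> E" and "is_log D \<xi> log\<xi>"
    and "\<forall>i\<in>{1..t}. \<forall>j\<in>{1..t}. i \<noteq> j \<longrightarrow> log\<alpha> i j \<in> E \<and> is_log D (\<alpha> i - \<alpha> j) (log\<alpha> i j)"
    \<comment> \<open>the logarithms and dilogarithms involving theta\<close>
    and "is_dilog D f l2f"
    and "\<forall>k\<in>{1..t}. is_log D (\<theta> - \<alpha> k) (log\<theta> k)"
    and "\<forall>j\<in>{1..t}. \<forall>k\<in>{1..t}. j \<noteq> k \<longrightarrow>
           is_log D ((\<theta> - \<alpha> j) / (\<theta> - \<alpha> k)) (logq j k) \<and>
           is_dilog D ((\<theta> - \<alpha> j) / (\<theta> - \<alpha> k)) (l2\<theta> j k)"
    and "degree P \<le> degree Q"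
  shows
    "(\<Sum>k=1..t. of_int (a k) * l2\<eta> + of_int (a k) * log\<eta> * log\<xi> - 1/2 * of_int (b k) * log\<eta> ^ 2)
        \<in> constants D F \<and>
     (\<Sum>k=1..t. of_int (a k) * log\<xi> - of_int (b k) * log\<eta>) \<in> constants D F \<and>
     (\<exists>c d e. D c = 0 \<and> (\<forall>k\<in>{1..t}. D (d k) = 0) \<and> D e = 0 \<and>
        l2f = l2\<eta>
          - (\<Sum>j=1..t. \<Sum>k\<in>{1..t} - {j}. of_int (a j) * of_int (b k) * l2\<theta> j k)
          - 1/2 * (\<Sum>j=1..t. \<Sum>k=1..t. of_int (a j) * of_int (b k) * log\<theta> k ^ 2)
          - (\<Sum>k=1..t. of_int (b k) * log\<theta> k * log\<eta>)
          - e * log\<eta> + (\<Sum>k=1..t. d k * log\<theta> k) + c) \<and>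
     (\<forall>j\<in>{1..t}. \<forall>k\<in>{1..t}. j \<noteq> k \<longrightarrow>
        (\<exists>c d. D c = 0 \<and> D d = 0 \<and>
           l2\<theta> j k = - l2\<theta> k j + log\<theta> j * log\<theta> k
             - 1/2 * (log\<theta> j ^ 2 + log\<theta> k ^ 2) + d * logq j k + c))"
proof -
  interpret field_derivation D
    using assms(1) by unfold_locales
  note const = assms(6) and monic = assms(15,16,17) and f_eq = assms(19) and R_eq = assms(20)
    and mn = assms(21,22) and inj = assms(24) and ab = assms(25,26,27)
    and P_def = assms(28) and Q_def = assms(29) and R_def = assms(30)
    and l2\<eta> = assms(35) and log\<eta> = assms(37) and log\<xi> = assms(39) and \<Lambda> = assms(40)
    and l2f = assms(41) and L = assms(42) and quot = assms(43) and deg = assms(44)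
  \<comment> \<open>Every constant of the ambient field already lies in \<open>F\<close>, so
    membership reduces to a vanishing derivative.\<close>
  have in_const: "x \<in> constants D F \<longleftrightarrow> D x = 0" for x
    using const by (auto simp: constants_def)
  have nz: "\<eta> \<noteq> 0" "\<xi> \<noteq> 0"
    using log\<eta> log\<xi> by (auto simp: is_log_def)
  have "\<forall>j\<in>{1..m}. b j = 0" "\<forall>j\<in>{m+1..n}. b j = a j" "\<forall>j\<in>{n+1..t}. a j = 0"
    using ab by auto
  note sums = sum_exponents_split[OF mn this]
  have dlogP: "dlog (poly P x) = (\<Sum>j=1..m. of_int (a j) * dlog (x - \<alpha> j))"
    if "poly P x \<noteq> 0" for x
    using that ab unfolding P_def by (intro dlog_poly_prod_linear) auto
  have dlogQ: "dlog (poly Q x) = (\<Sum>j=m+1..n. of_int (- a j) * dlog (x - \<alpha> j))"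
    if "poly Q x \<noteq> 0" for x
    using that ab unfolding Q_def by (intro dlog_poly_prod_linear) auto
  have dlogR: "dlog (poly R x) = (\<Sum>j=n+1..t. of_int (b j) * dlog (x - \<alpha> j))"
    if "poly R x \<noteq> 0" for x
    using that ab unfolding R_def by (intro dlog_poly_prod_linear) auto
  have rel: "\<xi> * poly R x = poly Q x - \<eta> * poly P x" for x
    using arg_cong[OF R_eq, of "\<lambda>p. poly p x"] by simp

  have degrees: "int (degree P) = (\<Sum>k=1..m. a k)" "int (degree Q) = (\<Sum>k=m+1..n. - a k)"
      "int (degree R) = (\<Sum>k=n+1..t. b k)"
    unfolding P_def Q_def R_def using ab by (intro degree_prod_linear; force)+
  have sum_a: "(\<Sum>k=1..t. a k) = int (degree P) - int (degree Q)"
    and sum_b: "(\<Sum>k=1..t. b k) = int (degree R) - int (degree Q)"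
    unfolding degrees using sums[of "\<lambda>_. 1 :: int"] by simp_all
  note lead = leading_coeff_monic_diff[OF monic R_eq deg]

  define S\<^sub>a S\<^sub>b :: 'a where "S\<^sub>a = of_int (\<Sum>k=1..t. a k)" and "S\<^sub>b = of_int (\<Sum>k=1..t. b k)"
  have S1: "(\<Sum>k=1..t. of_int (a k) * l2\<eta> + of_int (a k) * log\<eta> * log\<xi>
      - 1/2 * of_int (b k) * log\<eta> ^ 2) = S\<^sub>a * (l2\<eta> + log\<eta> * log\<xi>) - S\<^sub>b / 2 * log\<eta> ^ 2"
    by (simp add: S\<^sub>a_def S\<^sub>b_def sum.distrib sum_subtractf sum_distrib_right sum_distrib_left
        sum_divide_distrib algebra_simps)
  have S2: "(\<Sum>k=1..t. of_int (a k) * log\<xi> - of_int (b k) * log\<eta>) = S\<^sub>a * log\<xi> - S\<^sub>b * log\<eta>"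
    by (simp add: S\<^sub>a_def S\<^sub>b_def sum_subtractf sum_distrib_right)
  have Sa_eq: "S\<^sub>a = of_int (int (degree P) - int (degree Q))"
    and Sb_eq: "S\<^sub>b = of_int (int (degree R) - int (degree Q))"
    unfolding S\<^sub>a_def S\<^sub>b_def sum_a sum_b by (rule refl)+
  have [simp]: "D S\<^sub>a = 0" "D S\<^sub>b = 0"
    unfolding S\<^sub>a_def S\<^sub>b_def by (rule D_of_int)+
  note [simp] = D_is_log[OF log\<eta>] D_is_log[OF log\<xi>]

  \<comment> \<open>In the generic case all three degrees agree and both exponent sums vanish. If
    \<eta> = 1, the derivatives of \<open>log\<eta>\<close> and \<open>l2\<eta>\<close> vanish. If
    \<open>degree P < degree Q\<close>, then \<xi> = 1 and the derivative of \<open>l2\<eta>\<close>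
    cancels that of the product of the logarithms.\<close>
  consider (generic) "degree P = degree Q" "\<eta> \<noteq> 1" | (one) "degree P = degree Q" "\<eta> = 1"
    | (less) "degree P < degree Q"
    using deg by linarith
  then have "D (S\<^sub>a * (l2\<eta> + log\<eta> * log\<xi>) - S\<^sub>b / 2 * log\<eta> ^ 2) = 0 \<and>
      D (S\<^sub>a * log\<xi> - S\<^sub>b * log\<eta>) = 0 \<and> (\<exists>e. D e = 0 \<and> D l2\<eta> = dlog \<eta> * (e - log\<xi>))"
  proof cases
    case generic
    then have "S\<^sub>a = 0" "S\<^sub>b = 0" "\<xi> = 1 - \<eta>"
      using lead by (simp_all add: Sa_eq Sb_eq)
    moreover have "is_dilog D \<eta> l2\<eta>"
      using l2\<eta> generic by (simp add: is_leading_dilog_def)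
    ultimately show ?thesis
      using is_dilog_derivE[of \<eta> l2\<eta> log\<xi>] by auto
  next
    case one
    then have "S\<^sub>a = 0"
      by (simp add: Sa_eq)
    then show ?thesis
      using l2\<eta> one by (auto simp: is_leading_dilog_def dlog_def intro!: exI[of _ 0])
  next
    case less
    then have "S\<^sub>b = 0" "\<xi> = 1"
      using lead by (simp_all add: Sb_eq)
    then show ?thesis
      using l2\<eta> less by (auto simp: is_leading_dilog_def dlog_def intro!: exI[of _ 0])
  qed
  then obtain e\<^sub>0 where
    S1_const: "D (S\<^sub>a * (l2\<eta> + log\<eta> * log\<xi>) - S\<^sub>b / 2 * log\<eta> ^ 2) = 0" and
    S2_const: "D (S\<^sub>a * log\<xi> - S\<^sub>b * log\<eta>) = 0" and
    e\<^sub>0: "D e\<^sub>0 = 0" "D l2\<eta> = dlog \<eta> * (e\<^sub>0 - log\<xi>)"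
    by blast

  have f01: "f \<noteq> 0" "1 - f \<noteq> 0"
    using l2f by (auto simp: is_dilog_def)
  \<comment> \<open>As \<open>x / 0 = 0\<close>, a zero of either value would force
    \<open>f = 0\<close>.\<close>
  then have polynz: "poly P \<theta> \<noteq> 0" "poly Q \<theta> \<noteq> 0"
    using f_eq by auto
  then have "1 - f = \<xi> * poly R \<theta> / poly Q \<theta>"
    unfolding f_eq by (simp add: rel diff_divide_distrib)
  moreover from this have Rnz: "poly R \<theta> \<noteq> 0"
    using f01 by auto
  ultimately have dlog_1f: "dlog (1 - f) = dlog \<xi> + (\<Sum>k=1..t. of_int (b k) * dlog (\<theta> - \<alpha> k))"
    using nz polynz unfolding sums by (simp add: dlog_divide dlog_mult dlogQ dlogR)
  have dlog_f: "dlog f = dlog \<eta> + (\<Sum>k=1..t. of_int (a k) * dlog (\<theta> - \<alpha> k))"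
    using nz polynz unfolding f_eq sums by (simp add: dlog_divide dlog_mult dlogP dlogQ)

  have compat: "of_int (a k) * (dlog \<xi> + (\<Sum>j=1..t. of_int (b j) * dlog (\<alpha> k - \<alpha> j))) =
      of_int (b k) * (dlog \<eta> + (\<Sum>j=1..t. of_int (a j) * dlog (\<alpha> k - \<alpha> j)))"
    if k: "k \<in> {1..t}" for k
  proof -
    have "poly P (\<alpha> k) = 0 \<longleftrightarrow> k \<in> {1..m}"
      unfolding P_def using ab mn k by (intro poly_prod_linear_eq_0_iff[OF _ inj]) auto
    then have P0: "poly P (\<alpha> k) = 0 \<longleftrightarrow> k \<le> m"
      using k by simp
    have "poly Q (\<alpha> k) = 0 \<longleftrightarrow> k \<in> {m+1..n}"
      unfolding Q_def using ab mn k by (intro poly_prod_linear_eq_0_iff[OF _ inj]) auto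
    then have Q0: "poly Q (\<alpha> k) = 0 \<longleftrightarrow> m < k \<and> k \<le> n"
      by auto
    have "poly R (\<alpha> k) = 0 \<longleftrightarrow> k \<in> {n+1..t}"
      unfolding R_def using ab mn k by (intro poly_prod_linear_eq_0_iff[OF _ inj]) auto
    then have R0: "poly R (\<alpha> k) = 0 \<longleftrightarrow> n < k"
      using k by auto
    \<comment> \<open>The cases are the roots of \<open>P\<close>, \<open>Q\<close> and
      \<open>R\<close>. At a root of \<open>P\<close> or \<open>R\<close> one side of the claim is
      zero; at a root of \<open>Q\<close> the exponents agree and the sums over the roots of
      \<open>Q\<close> cancel. The two surviving values of the polynomial relation agree up to
      sign.\<close>
    consider "k \<le> m" | "m < k" "k \<le> n" | "n < k"
      by linarith
    then show ?thesis
    proof cases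
      case 1
      then have "dlog (poly Q (\<alpha> k)) = dlog (\<xi> * poly R (\<alpha> k))"
        using P0 by (simp add: rel)
      then show ?thesis
        using 1 P0 Q0 R0 mn ab k nz unfolding sums by (simp add: dlog_mult dlogQ dlogR)
    next
      case 2
      then have "dlog (\<eta> * poly P (\<alpha> k)) = dlog (\<xi> * poly R (\<alpha> k))"
        using Q0 by (simp add: rel)
      then show ?thesis
        using 2 P0 Q0 R0 mn ab k nz unfolding sums by (simp add: dlog_mult dlogP dlogR)
    next
      case 3
      then have "dlog (poly Q (\<alpha> k)) = dlog (\<eta> * poly P (\<alpha> k))"
        using R0 rel[of "\<alpha> k"] by simp
      then show ?thesis
        using 3 P0 Q0 R0 mn ab k nz unfolding sums by (simp add: dlog_mult dlogP dlogQ)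
    qed
  qed

  show ?thesis
  proof (intro conjI)
    show "(\<Sum>k=1..t. of_int (a k) * l2\<eta> + of_int (a k) * log\<eta> * log\<xi>
        - 1/2 * of_int (b k) * log\<eta> ^ 2) \<in> constants D F"
      unfolding S1 in_const by (rule S1_const)
    show "(\<Sum>k=1..t. of_int (a k) * log\<xi> - of_int (b k) * log\<eta>) \<in> constants D F"
      unfolding S2 in_const by (rule S2_const)
    show "\<exists>c d e. D c = 0 \<and> (\<forall>k\<in>{1..t}. D (d k) = 0) \<and> D e = 0 \<and>
        l2f = l2\<eta>
          - (\<Sum>j=1..t. \<Sum>k\<in>{1..t} - {j}. of_int (a j) * of_int (b k) * l2\<theta> j k)
          - 1/2 * (\<Sum>j=1..t. \<Sum>k=1..t. of_int (a j) * of_int (b k) * log\<theta> k ^ 2)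
          - (\<Sum>k=1..t. of_int (b k) * log\<theta> k * log\<eta>)
          - e * log\<eta> + (\<Sum>k=1..t. d k * log\<theta> k) + c"
      \<comment> \<open>The logarithms of the root differences are named explicitly because they do
        not occur in the goal.\<close>
      using inj L \<Lambda> quot
      by (intro dilog_product_expansion[where \<Lambda> = log\<alpha>,
            OF _ _ _ _ dlog_f dlog_1f compat log\<eta> log\<xi> e\<^sub>0 _ _ _ l2f]) auto
    show "\<forall>j\<in>{1..t}. \<forall>k\<in>{1..t}. j \<noteq> k \<longrightarrow>
        (\<exists>c d. D c = 0 \<and> D d = 0 \<and>
           l2\<theta> j k = - l2\<theta> k j + log\<theta> j * log\<theta> k
             - 1/2 * (log\<theta> j ^ 2 + log\<theta> k ^ 2) + d * logq j k + c)"
    proof (intro ballI impI)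
      fix j k
      assume jk: "j \<in> {1..t}" "k \<in> {1..t}" "j \<noteq> k"
      moreover have "\<alpha> j \<noteq> \<alpha> k"
        using inj_onD[OF inj] jk by metis
      ultimately show "\<exists>c d. D c = 0 \<and> D d = 0 \<and>
           l2\<theta> j k = - l2\<theta> k j + log\<theta> j * log\<theta> k
             - 1/2 * (log\<theta> j ^ 2 + log\<theta> k ^ 2) + d * logq j k + c"
        using L \<Lambda> quot
        by (intro dilog_quotient_inversion[where w = "log\<alpha> j k" and w' = "log\<alpha> k j"]) auto
    qed
  qed
qed

end
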